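(* Let $\ell,L,H,\mathcal{L}>0$ be real numbers such that $$\frac{\ell+L+\mathcal{L}}{H}\in\mathbb{Q},$$ and let $$I=[0,\ell]\cup[\ell+H,\ \ell+H+L]\cup[\ell+L+2H,\ \ell+L+\mathcal{L}+2H].$$ Then the implication $$\Big(\exists\, C\in\mathbb{R}\ \ \forall\,\sigma\in\Sigma\quad \int_{\sigma(I)}f=C\Big)\ \Longrightarrow\ f\text{ is constant}$$ does not hold for all continuous functions $f:\mathbb{R}\to\mathbb{R}$; that is, there exist a non-constant continuous function $f:\mathbb{R}\to\mathbb{R}$ and $C\in\mathbb{R}$ such that $\int_{\sigma(I)}f=C$ for every $\sigma\in\Sigma$.
   Context: $\Sigma$ denotes the set of all isometries of $\mathbb{R}$, i.e. the maps $x\mapsto t+x$ and $x\mapsto t-x$ with $t\in\mathbb{R}$. *)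

theory Defs
  imports "HOL-Analysis.Analysis"
begin

definition real_isometries :: "(real \<Rightarrow> real) set" where
  "real_isometries = {\<sigma>. \<forall>x y. dist (\<sigma> x) (\<sigma> y) = dist x y}"

lemma real_isometries_eq:
  "real_isometries = range (\<lambda>t x. t + x) \<union> range (\<lambda>t x. t - x)"
proof (intro equalityI subsetI)
  fix \<sigma> :: "real \<Rightarrow> real"
  assume "\<sigma> \<in> real_isometries"
  then have iso: "\<bar>\<sigma> x - \<sigma> y\<bar> = \<bar>x - y\<bar>" for x y
    by (simp add: real_isometries_def dist_real_def)
  have "\<sigma> 1 = \<sigma> 0 + 1 \<or> \<sigma> 1 = \<sigma> 0 - 1"
    using iso[of 1 0] by arith
  then show "\<sigma> \<in> range (\<lambda>t x. t + x) \<union> range (\<lambda>t x. t - x)"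
  proof
    assume *: "\<sigma> 1 = \<sigma> 0 + 1"
    have "\<sigma> x = \<sigma> 0 + x" for x
      using iso[of x 0] iso[of x 1] * by arith
    then have "\<sigma> = (\<lambda>x. \<sigma> 0 + x)" by blast
    then show ?thesis by blast
  next
    assume *: "\<sigma> 1 = \<sigma> 0 - 1"
    have "\<sigma> x = \<sigma> 0 - x" for x
      using iso[of x 0] iso[of x 1] * by arith
    then have "\<sigma> = (\<lambda>x. \<sigma> 0 - x)" by blast
    then show ?thesis by blast
  qed
next
  fix \<sigma> :: "real \<Rightarrow> real"
  assume "\<sigma> \<in> range (\<lambda>t x. t + x) \<union> range (\<lambda>t x. t - x)"
  then show "\<sigma> \<in> real_isometries"
    by (auto simp: real_isometries_def dist_real_def)
qed

end

theory Submission
  imports Defs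
begin

text \<open>
  Write \<open>S = l + L + \<L>\<close> and \<open>S / H = p / q\<close> with \<open>p\<close>, \<open>q\<close> integers. The number \<open>H / q\<close> then divides
  both \<open>H\<close> and \<open>S\<close>, so the wave \<open>f x = cos (2 * pi * q / H * x)\<close> and its antiderivative \<open>F\<close> (a
  multiple of the corresponding sine) have both \<open>H\<close> and \<open>S\<close> as periods. Because both gaps of \<open>I\<close> have
  length \<open>H\<close>, \<open>F\<close> takes equal values at the two ends of each gap of any isometric copy of \<open>I\<close>: the
  gaps are invisible to \<open>F\<close>, and the integral telescopes to the increment of \<open>F\<close> over an
  interval of length \<open>S\<close>, which is zero. Lemma \<open>integral_isometric_copy_eq_0\<close> carries out this
  argument for every \<open>F\<close> with these two periods. Hence \<open>C = 0\<close> works for this non-constant \<open>f\<close>.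
\<close>

lemma integral_three_intervals:
  fixes F f :: "real \<Rightarrow> real"
  assumes deriv: "\<And>x. (F has_real_derivative f x) (at x)"
    and ord: "a \<le> b" "b < c" "c \<le> d" "d < e" "e \<le> g"
  shows "integral ({a..b} \<union> {c..d} \<union> {e..g}) f = (F b - F a) + (F d - F c) + (F g - F e)"
proof -
  have FTC: "(f has_integral F v - F u) {u..v}" if "u \<le> v" for u v
    using that deriv
    by (intro fundamental_theorem_of_calculus)
       (auto simp flip: has_real_derivative_iff_has_vector_derivative
             intro: has_field_derivative_at_within)
  have "{a..b} \<inter> {c..d} = {}" "({a..b} \<union> {c..d}) \<inter> {e..g} = {}"
    using ord by auto
  then have "(f has_integral (F b - F a) + (F d - F c) + (F g - F e)) ({a..b} \<union> {c..d} \<union> {e..g})"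
    using FTC ord by (intro has_integral_Un) auto
  then show ?thesis
    by (rule integral_unique)
qed

text \<open>
  The two classes of isometries are treated alike: a translate or a reflection of \<open>I\<close> again consists
  of three intervals separated by gaps of length \<open>H\<close>, in the reflected case traversed in the
  opposite order.
\<close>

lemma integral_isometric_copy_eq_0:
  fixes F f :: "real \<Rightarrow> real" and l L H \<L> :: real
  assumes deriv: "\<And>x. (F has_real_derivative f x) (at x)"
    and per_gap: "\<And>x. F (x + H) = F x"
    and per_total: "\<And>x. F (x + (l + L + \<L>)) = F x"
    and pos: "l > 0" "L > 0" "H > 0" "\<L> > 0"
    and \<sigma>: "\<sigma> \<in> real_isometries"
  shows "integral (\<sigma> ` ({0..l} \<union> {l + H..l + H + L} \<union> {l + L + 2 * H..l + L + \<L> + 2 * H})) f = 0"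
    (is "integral (\<sigma> ` ?I) f = 0")
proof -
  have per_2gap: "F (x + 2 * H) = F x" for x
    using per_gap[of x] per_gap[of "x + H"] by (simp add: algebra_simps)
  from \<sigma> consider t where "\<sigma> = (\<lambda>x. t + x)" | t where "\<sigma> = (\<lambda>x. t - x)"
    unfolding real_isometries_eq by blast
  then show ?thesis
  proof cases
    case (1 t)
    have "\<sigma> ` ?I = {t..t + l} \<union> {t + l + H..t + l + L + H}
        \<union> {t + l + L + 2 * H..t + (l + L + \<L>) + 2 * H}"
      by (simp add: 1 image_Un algebra_simps)
    then have "integral (\<sigma> ` ?I) f =
        (F (t + l) - F t) + (F (t + l + L + H) - F (t + l + H))
        + (F (t + (l + L + \<L>) + 2 * H) - F (t + l + L + 2 * H))"
      using pos by (simp add: integral_three_intervals[OF deriv])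
    then show ?thesis
      by (simp only: per_gap per_2gap per_total)
  next
    case (2 t)
    \<comment> \<open>The base point is the left end of the reflected set, so that all endpoints arise by adding
      periods and the periodicity equations rewrite them directly.\<close>
    define s where "s = t - (l + L + \<L>) - 2 * H"
    have "\<sigma> ` ?I = {s..s + \<L>} \<union> {s + \<L> + H..s + \<L> + L + H}
        \<union> {s + \<L> + L + 2 * H..s + (l + L + \<L>) + 2 * H}"
      by (simp add: 2 s_def image_Un algebra_simps Un_ac)
    then have "integral (\<sigma> ` ?I) f =
        (F (s + \<L>) - F s) + (F (s + \<L> + L + H) - F (s + \<L> + H))
        + (F (s + (l + L + \<L>) + 2 * H) - F (s + \<L> + L + 2 * H))"
      using pos by (simp add: integral_three_intervals[OF deriv])
    then show ?thesis
      by (simp only: per_gap per_2gap per_total)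
  qed
qed

theorem proposition3p1:
  fixes l L H \<L> :: real and I :: "real set"
  assumes "l > 0" and "L > 0" and "H > 0" and "\<L> > 0"
    and "(l + L + \<L>) / H \<in> \<rat>"
    and "I = {0..l} \<union> {l + H..l + H + L} \<union> {l + L + 2 * H..l + L + \<L> + 2 * H}"
  shows "\<exists>f :: real \<Rightarrow> real. continuous_on UNIV f \<and> \<not> f constant_on UNIV \<and>
    (\<exists>C. \<forall>\<sigma> \<in> real_isometries. integral (\<sigma> ` I) f = C)"
proof -
  obtain p q :: int where "q > 0" and pq: "(l + L + \<L>) / H = of_int p / of_int q"
    using assms(5) by (auto elim: Rats_cases')
  define w where "w = 2 * pi * of_int q / H"
  have "w > 0"
    using \<open>q > 0\<close> \<open>H > 0\<close> by (simp add: w_def)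
  have wH: "w * H = 2 * pi * of_int q"
    using \<open>H > 0\<close> by (simp add: w_def)
  have wS: "w * (l + L + \<L>) = 2 * pi * of_int p"
  proof -
    have "w * (l + L + \<L>) = 2 * pi * of_int q * ((l + L + \<L>) / H)"
      by (simp add: w_def)
    also have "\<dots> = 2 * pi * of_int p"
      unfolding pq using \<open>q > 0\<close> by simp
    finally show ?thesis .
  qed
  define f F :: "real \<Rightarrow> real" where "f = (\<lambda>x. cos (w * x))" and "F = (\<lambda>x. sin (w * x) / w)"
  have deriv: "(F has_real_derivative f x) (at x)" for x
    unfolding F_def f_def using \<open>w > 0\<close> by (auto intro!: derivative_eq_intros)
  have periodic: "F (x + T) = F x" if "w * T = 2 * pi * of_int n" for x T and n :: int
    by (simp add: F_def distrib_left that sin_add sin_int_2pin cos_int_2pin)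
  have "\<forall>\<sigma> \<in> real_isometries. integral (\<sigma> ` I) f = 0"
    using integral_isometric_copy_eq_0[OF deriv periodic[OF wH] periodic[OF wS]] assms(1-4)
    unfolding assms(6) by blast
  moreover have "continuous_on UNIV f"
    unfolding f_def by (intro continuous_intros)
  moreover have "\<not> f constant_on UNIV"
  proof -
    have "f 0 = 1" "f (pi / w) = -1"
      using \<open>w > 0\<close> by (simp_all add: f_def)
    then show ?thesis
      unfolding constant_on_def by (metis UNIV_I one_neq_neg_one)
  qed
  ultimately show ?thesis
    by blast
qed

end
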